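(* Let $k$ be a field of characteristic not equal to $3$, and let $B\subset\mathbb{P}^4$ be the quartic threefold over $k$ defined by $$y_0(y_0^3+y_1^3+y_2^3+y_3^3+y_4^3)+3y_1y_2y_3y_4=0.$$ Then $B$ is birational to $\mathbb{P}^3$ over $k$ by the rational map $\psi\colon B\dashrightarrow\mathbb{P}^3$, $(y_0:y_1:y_2:y_3:y_4)\mapsto(t_0:t_1:t_2:t_3)$, where $$\begin{aligned} t_0&=y_0(y_0^2-y_0y_1+y_1^2),\\ t_1&=y_0(y_1y_2-y_0y_3-y_0y_4),\\ t_2&=y_0(y_0y_2-y_1y_2+y_1y_3+y_1y_4),\\ t_3&=y_0y_1y_2-y_0y_1y_3+y_1^2y_3-y_0^2y_4. \end{aligned}$$
   Context: The threefold $B$ is called the Burkhardt quartic threefold; $(y_0:\cdots:y_4)$ are the homogeneous coordinates on $\mathbb{P}^4$ and $(t_0:\cdots:t_3)$ those on $\mathbb{P}^3$. *)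

theory Defs
  imports "HOL-Library.Poly_Mapping" "HOL-Library.Numeral_Type"
begin

section \<open>Polynomials in finitely many variables\<close>

text \<open>
  The type \<open>('i, 'k) mpoly\<close> is the polynomial ring over \<open>'k\<close> with one variable for each element of
  \<open>'i\<close>.  With \<open>'i\<close> a finite type having \<open>n + 1\<close> elements it is the homogeneous coordinate ring of
  projective \<open>n\<close>-space.  Since the ground field may be finite, polynomials are kept as formal
  objects throughout and are never replaced by functions on rational points.
\<close>

type_synonym ('i, 'k) mpoly = "('i \<Rightarrow>\<^sub>0 nat) \<Rightarrow>\<^sub>0 'k"

definition var :: "'i \<Rightarrow> ('i, 'k::comm_ring_1) mpoly" where
  "var i = Poly_Mapping.single (Poly_Mapping.single i 1) 1"

definition const :: "'k::comm_ring_1 \<Rightarrow> ('i, 'k) mpoly" where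
  "const c = Poly_Mapping.single 0 c"

definition monom_degree :: "('i::finite \<Rightarrow>\<^sub>0 nat) \<Rightarrow> nat" where
  "monom_degree m = (\<Sum>i\<in>UNIV. Poly_Mapping.lookup m i)"

definition homogeneous :: "nat \<Rightarrow> ('i::finite, 'k::comm_ring_1) mpoly \<Rightarrow> bool" where
  "homogeneous d p \<longleftrightarrow> (\<forall>m\<in>Poly_Mapping.keys p. monom_degree m = d)"

definition homogeneous_component ::
    "nat \<Rightarrow> ('i::finite, 'k::comm_ring_1) mpoly \<Rightarrow> ('i, 'k) mpoly" where
  "homogeneous_component d p =
     (\<Sum>m\<in>{m \<in> Poly_Mapping.keys p. monom_degree m = d}.
        Poly_Mapping.single m (Poly_Mapping.lookup p m))"

definition subst ::
    "('i::finite \<Rightarrow> ('j, 'k::comm_ring_1) mpoly) \<Rightarrow> ('i, 'k) mpoly \<Rightarrow> ('j, 'k) mpoly" where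
  "subst f p =
     (\<Sum>m\<in>Poly_Mapping.keys p.
        const (Poly_Mapping.lookup p m) * (\<Prod>i\<in>UNIV. f i ^ Poly_Mapping.lookup m i))"


section \<open>Projective varieties\<close>

text \<open>
  A projective variety over \<open>'k\<close> is an integral closed subscheme of projective space.  It is given by
  its homogeneous ideal, a homogeneous prime ideal that does not contain all the variables.
\<close>

definition prime_ideal :: "'r::comm_ring_1 set \<Rightarrow> bool" where
  "prime_ideal I \<longleftrightarrow>
     0 \<in> I \<and> (\<forall>a\<in>I. \<forall>b\<in>I. a + b \<in> I) \<and> (\<forall>r. \<forall>a\<in>I. r * a \<in> I) \<and>
     1 \<notin> I \<and> (\<forall>a b. a * b \<in> I \<longrightarrow> a \<in> I \<or> b \<in> I)"

definition projective_variety :: "('i::finite, 'k::field) mpoly set \<Rightarrow> bool" where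
  "projective_variety I \<longleftrightarrow>
     prime_ideal I \<and>
     (\<forall>p\<in>I. \<forall>d. homogeneous_component d p \<in> I) \<and>
     (\<exists>i. var i \<notin> I)"

definition projective_space :: "('i::finite, 'k::field) mpoly set" where
  "projective_space = {0}"

definition hypersurface :: "('i::finite, 'k::field) mpoly \<Rightarrow> ('i, 'k) mpoly set" where
  "hypersurface F = {p. F dvd p}"


section \<open>Rational and birational maps\<close>

text \<open>
  Let \<open>I\<close> and \<open>J\<close> be the ideals of two projective varieties.  A rational map from the first to the
  second is represented by a family \<open>f\<close> of forms of the same degree, one for each homogeneous
  coordinate of the target and not all vanishing on the source, such that the closure of the image
  lies in the target.  Two families represent the same rational map iff they are proportional on the
  source.
\<close>

definition rational_map ::
    "('i::finite, 'k::field) mpoly set \<Rightarrow> ('j::finite, 'k) mpoly set \<Rightarrow>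
     ('j \<Rightarrow> ('i, 'k) mpoly) \<Rightarrow> bool" where
  "rational_map I J f \<longleftrightarrow>
     (\<exists>d. \<forall>j. homogeneous d (f j)) \<and> (\<exists>j. f j \<notin> I) \<and> (\<forall>q\<in>J. subst f q \<in> I)"

definition same_rational_map ::
    "('i::finite, 'k::field) mpoly set \<Rightarrow> ('j \<Rightarrow> ('i, 'k) mpoly) \<Rightarrow> ('j \<Rightarrow> ('i, 'k) mpoly) \<Rightarrow> bool"
  where "same_rational_map I f g \<longleftrightarrow> (\<forall>a b. f a * g b - f b * g a \<in> I)"

text \<open>
  Dominance: every form vanishing on the image vanishes on the target.
\<close>

definition dominant ::
    "('i::finite, 'k::field) mpoly set \<Rightarrow> ('j::finite, 'k) mpoly set \<Rightarrow>
     ('j \<Rightarrow> ('i, 'k) mpoly) \<Rightarrow> bool" where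
  "dominant I J f \<longleftrightarrow> (\<forall>e q. homogeneous e q \<and> subst f q \<in> I \<longrightarrow> q \<in> J)"

text \<open>
  The composite \<open>g \<circ> f\<close>, by substitution.  If \<open>f\<close> is dominant, the resulting forms do not all vanish
  on the source of \<open>f\<close>, and the rational map they represent does not depend on the representatives.
\<close>

definition rational_comp ::
    "('l \<Rightarrow> ('j::finite, 'k::field) mpoly) \<Rightarrow> ('j \<Rightarrow> ('i::finite, 'k) mpoly) \<Rightarrow>
     'l \<Rightarrow> ('i, 'k) mpoly" where
  "rational_comp g f l = subst f (g l)"

text \<open>
  The family \<open>var\<close> of the coordinates represents the identity.  The inverse map has coefficients in
  the same field \<open>'k\<close>.
\<close>

definition birational_map ::
    "('i::finite, 'k::field) mpoly set \<Rightarrow> ('j::finite, 'k) mpoly set \<Rightarrow>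
     ('j \<Rightarrow> ('i, 'k) mpoly) \<Rightarrow> bool" where
  "birational_map I J f \<longleftrightarrow>
     projective_variety I \<and> projective_variety J \<and>
     rational_map I J f \<and> dominant I J f \<and>
     (\<exists>g. rational_map J I g \<and> dominant J I g \<and>
          same_rational_map I (rational_comp g f) var \<and>
          same_rational_map J (rational_comp f g) var)"


section \<open>The Burkhardt quartic\<close>

text \<open>
  The index types \<open>5\<close> and \<open>4\<close> consist of the residues \<open>0, \<dots>, 4\<close> and \<open>0, \<dots>, 3\<close>, so they index the
  homogeneous coordinates on projective spaces of dimensions four and three.
\<close>

definition burkhardt_form :: "(5, 'k::field) mpoly" where
  "burkhardt_form =
     var 0 * (var 0 ^ 3 + var 1 ^ 3 + var 2 ^ 3 + var 3 ^ 3 + var 4 ^ 3)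
     + 3 * var 1 * var 2 * var 3 * var 4"

definition burkhardt_psi :: "4 \<Rightarrow> (5, 'k::field) mpoly" where
  "burkhardt_psi j =
     (let y0 = var 0; y1 = var 1; y2 = var 2; y3 = var 3; y4 = var 4 in
      if j = 0 then y0 * (y0 ^ 2 - y0 * y1 + y1 ^ 2)
      else if j = 1 then y0 * (y1 * y2 - y0 * y3 - y0 * y4)
      else if j = 2 then y0 * (y0 * y2 - y1 * y2 + y1 * y3 + y1 * y4)
      else y0 * y1 * y2 - y0 * y1 * y3 + y1 ^ 2 * y3 - y0 ^ 2 * y4)"

end

(*
  The fibres of psi on projective 4-space are lines, and the quartic form restricted to the line over
  t is, up to a factor supported where y0 (y0^2 - y0 y1 + y1^2) = 0, a linear form
  den(t) y1 - num(t) y0. Solving it for (y1 : y0) = (num : den) gives the inverse g.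

  All conditions follow once the kernel of substitution of g is the ideal generated by the quartic
  form F; in particular this ideal is then prime. The kernel is graded since the components of g are
  homogeneous of the same degree. A form p in the kernel, restricted to the fibre line, vanishes at
  (num : den), hence is divisible by den u - num v, which is prime because den is prime and does not
  divide num v. Substituting t = psi(y), u = y1, v = y0 shows that F divides
  (y0 (y0^2 - y0 y1 + y1^2))^e p, and the first factor is coprime to F.
*)
theory Submission
  imports Defs "HOL-Computational_Algebra.Polynomial" "HOL-Computational_Algebra.Primes"
begin

section \<open>Evaluation homomorphisms\<close>

definition ring_hom_fun :: "('a::comm_ring_1 \<Rightarrow> 'b::comm_ring_1) \<Rightarrow> bool" where
  "ring_hom_fun h \<longleftrightarrow> h 1 = 1 \<and> (\<forall>a b. h (a + b) = h a + h b) \<and> (\<forall>a b. h (a * b) = h a * h b)"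

context
  fixes h :: "'a::comm_ring_1 \<Rightarrow> 'b::comm_ring_1"
  assumes h: "ring_hom_fun h"
begin

lemma hom_one: "h 1 = 1"
  and hom_add: "h (a + b) = h a + h b"
  and hom_mult: "h (a * b) = h a * h b"
  using h by (auto simp: ring_hom_fun_def)

lemma hom_zero: "h 0 = 0"
  using hom_add[of 0 0] by simp

lemma hom_uminus: "h (- a) = - h a"
  using hom_add[of a "- a"] by (simp add: hom_zero eq_neg_iff_add_eq_0 add.commute)

lemma hom_diff: "h (a - b) = h a - h b"
  using hom_add[of a "- b"] by (simp add: hom_uminus)

lemma hom_power: "h (a ^ n) = h a ^ n"
  by (induction n) (simp_all add: hom_one hom_mult)

lemma hom_of_nat: "h (of_nat n) = of_nat n"
  by (induction n) (simp_all add: hom_zero hom_one hom_add)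

lemma hom_numeral: "h (numeral n) = numeral n"
  using hom_of_nat[of "numeral n"] by simp

lemma hom_sum: "h (\<Sum>x\<in>S. f x) = (\<Sum>x\<in>S. h (f x))"
  by (induction S rule: infinite_finite_induct) (simp_all add: hom_zero hom_add)

lemma hom_prod: "h (\<Prod>x\<in>S. f x) = (\<Prod>x\<in>S. h (f x))"
  by (induction S rule: infinite_finite_induct) (simp_all add: hom_one hom_mult)

lemma hom_dvd: "a dvd b \<Longrightarrow> h a dvd h b"
  by (auto simp: dvd_def hom_mult)

lemmas hom_simps = hom_zero hom_one hom_add hom_mult hom_uminus hom_diff hom_power hom_numeral

end

text \<open>A coefficient homomorphism \<open>h\<close> is allowed besides the values of the
  variables, so that the same facts serve substitution (\<open>h = const\<close>), evaluation at
  points of \<open>k\<close> and passage to univariate polynomials.\<close>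

definition eval_mpoly ::
    "('k::comm_ring_1 \<Rightarrow> 'r::comm_ring_1) \<Rightarrow> ('i::finite \<Rightarrow> 'r) \<Rightarrow> ('i, 'k) mpoly \<Rightarrow> 'r" where
  "eval_mpoly h f p =
     (\<Sum>m\<in>Poly_Mapping.keys p. h (Poly_Mapping.lookup p m) * (\<Prod>i\<in>UNIV. f i ^ Poly_Mapping.lookup m i))"

lemma subst_eq_eval_mpoly: "subst f = eval_mpoly const f"
  by (simp add: fun_eq_iff subst_def eval_mpoly_def)

lemma mpoly_eq_sum_single:
  "p = (\<Sum>m\<in>Poly_Mapping.keys p. Poly_Mapping.single m (Poly_Mapping.lookup p m))"
  by (rule poly_mapping_eqI)
    (simp add: lookup_sum lookup_single when_def not_in_keys_iff_lookup_eq_zero)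

lemma mpoly_induct [case_names zero single add]:
  fixes p :: "('i, 'k::comm_ring_1) mpoly"
  assumes "P 0" "\<And>m c. P (Poly_Mapping.single m c)" "\<And>p q. P p \<Longrightarrow> P q \<Longrightarrow> P (p + q)"
  shows "P p"
proof -
  have "P (\<Sum>m\<in>S. Poly_Mapping.single m (Poly_Mapping.lookup p m))" if "finite S" for S
    using that by (induction S) (auto intro: assms)
  from this[OF finite_keys[of p]] show ?thesis
    by (subst mpoly_eq_sum_single)
qed

lemma ring_hom_fun_const: "ring_hom_fun const"
  by (auto simp: ring_hom_fun_def const_def single_add mult_single)

lemma ring_hom_fun_id: "ring_hom_fun (\<lambda>x. x)"
  by (simp add: ring_hom_fun_def)

lemma ring_hom_fun_const_poly: "ring_hom_fun h \<Longrightarrow> ring_hom_fun (\<lambda>x. [:h x:])"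
  by (simp add: ring_hom_fun_def)

lemma ring_hom_fun_poly: "ring_hom_fun (\<lambda>p. poly p x)"
  by (simp add: ring_hom_fun_def)

context
  fixes h :: "'k::comm_ring_1 \<Rightarrow> 'r::comm_ring_1"
  assumes h: "ring_hom_fun h"
begin

lemma eval_mpoly_superset:
  assumes "finite S" "Poly_Mapping.keys p \<subseteq> S"
  shows "eval_mpoly h f p =
    (\<Sum>m\<in>S. h (Poly_Mapping.lookup p m) * (\<Prod>i\<in>UNIV. f i ^ Poly_Mapping.lookup m i))"
  unfolding eval_mpoly_def
  by (rule sum.mono_neutral_left) (use assms in \<open>auto simp: in_keys_iff hom_zero[OF h]\<close>)

lemma eval_mpoly_single:
  "eval_mpoly h f (Poly_Mapping.single m c) = h c * (\<Prod>i\<in>UNIV. f i ^ Poly_Mapping.lookup m i)"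
  by (subst eval_mpoly_superset[of "{m}"]) auto

lemma eval_mpoly_add: "eval_mpoly h f (p + q) = eval_mpoly h f p + eval_mpoly h f q"
proof -
  let ?S = "Poly_Mapping.keys p \<union> Poly_Mapping.keys q"
  have "finite ?S" "Poly_Mapping.keys (p + q) \<subseteq> ?S"
    by (auto dest: subsetD[OF Poly_Mapping.keys_add])
  then show ?thesis
    by (simp add: eval_mpoly_superset[of ?S] lookup_add hom_add[OF h] sum.distrib algebra_simps)
qed

lemma eval_mpoly_mult: "eval_mpoly h f (p * q) = eval_mpoly h f p * eval_mpoly h f q"
proof (induction p rule: mpoly_induct)
  case (single m c)
  show ?case
  proof (induction q rule: mpoly_induct)
    case (single n d)
    show ?case
      by (simp add: mult_single eval_mpoly_single hom_mult[OF h] lookup_add power_add prod.distrib)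
  qed (simp_all add: eval_mpoly_add distrib_left, simp add: eval_mpoly_def)
qed (simp_all add: eval_mpoly_add distrib_right, simp add: eval_mpoly_def)

lemma ring_hom_fun_eval_mpoly: "ring_hom_fun (eval_mpoly h f)"
proof -
  have "eval_mpoly h f 1 = 1"
    using eval_mpoly_single[of f 0 1] by (simp add: hom_one[OF h])
  then show ?thesis
    by (simp add: ring_hom_fun_def eval_mpoly_add eval_mpoly_mult)
qed

lemma eval_mpoly_const: "eval_mpoly h f (const c) = h c"
  by (simp add: const_def eval_mpoly_single)

lemma eval_mpoly_var: "eval_mpoly h f (var i) = f i"
proof -
  have "(\<Prod>j\<in>UNIV. f j ^ (1 when i = j)) = (\<Prod>j\<in>UNIV. if j = i then f j else 1)"
    by (rule prod.cong) auto
  then show ?thesis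
    by (simp add: var_def eval_mpoly_single hom_one[OF h] lookup_single)
qed

text \<open>Congruent arguments give congruent values modulo \<open>L\<close>: telescoping handles
  products, and \<open>x - y\<close> divides \<open>x ^ n - y ^ n\<close>.\<close>

lemma eval_mpoly_dvd_diff:
  assumes "\<And>i. L dvd f i - g i"
  shows "L dvd eval_mpoly h f p - eval_mpoly h g p"
proof -
  have pow: "L dvd x ^ n - y ^ n" if "L dvd x - y" for x y :: 'r and n
    using dvd_trans[OF that] by (simp add: power_diff_sumr2)
  have "L dvd (\<Prod>i\<in>S. f i ^ m i) - (\<Prod>i\<in>S. g i ^ m i)" if "finite S" for S and m
    using that
  proof (induction S)
    case (insert i S)
    have "a * b - c * d = (a - c) * b + c * (b - d)" for a b c d :: 'r
      by (simp add: algebra_simps)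
    then show ?case
      using insert pow[OF assms] by (simp add: dvd_add)
  qed simp
  then show ?thesis
    unfolding eval_mpoly_def sum_subtractf[symmetric] right_diff_distrib[symmetric]
    by (intro dvd_sum dvd_mult) simp
qed

end

lemma hom_eval_mpoly:
  assumes "ring_hom_fun \<phi>"
  shows "\<phi> (eval_mpoly h f p) = eval_mpoly (\<lambda>c. \<phi> (h c)) (\<lambda>i. \<phi> (f i)) p"
  by (simp add: eval_mpoly_def hom_sum[OF assms] hom_mult[OF assms] hom_prod[OF assms]
      hom_power[OF assms])

lemma subst_var: "subst var p = p"
proof -
  have "subst var (p::('a,'b)mpoly) = eval_mpoly const var p"
    by (simp add: subst_eq_eval_mpoly)
  also have "\<dots> = p"
  proof (induction p rule: mpoly_induct)
    case (single m c)
    have *: "(\<Prod>i\<in>S. var i ^ f i) =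
        (Poly_Mapping.single (\<Sum>i\<in>S. Poly_Mapping.single i (f i)) 1 :: ('a, 'b) mpoly)"
      if "finite S" for S and f :: "'a \<Rightarrow> nat"
    proof -
      have "(var i ^ n :: ('a, 'b) mpoly) = Poly_Mapping.single (Poly_Mapping.single i n) 1" for i n
        by (induction n) (simp_all add: var_def mult_single single_add[symmetric])
      with that show ?thesis
        by (induction S) (simp_all add: mult_single)
    qed
    have "(\<Sum>i\<in>UNIV. Poly_Mapping.single i (Poly_Mapping.lookup m i)) = m"
      by (rule poly_mapping_eqI) (simp add: lookup_sum lookup_single when_def)
    then show ?case
      unfolding eval_mpoly_single[OF ring_hom_fun_const]
      by (simp add: * const_def mult_single)
  qed (simp_all add: eval_mpoly_add ring_hom_fun_const, simp add: eval_mpoly_def)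
  finally show ?thesis .
qed

lemma ring_hom_fun_subst: "ring_hom_fun (subst f)"
  by (simp add: subst_eq_eval_mpoly ring_hom_fun_eval_mpoly ring_hom_fun_const)

lemma subst_of_var: "subst f (var i) = f i"
  by (simp add: subst_eq_eval_mpoly eval_mpoly_var ring_hom_fun_const)

lemma subst_subst: "subst f (subst g p) = subst (\<lambda>i. subst f (g i)) p"
proof -
  have "subst f (eval_mpoly const g p) = eval_mpoly (\<lambda>c. subst f (const c)) (\<lambda>i. subst f (g i)) p"
    by (rule hom_eval_mpoly[OF ring_hom_fun_subst])
  then show ?thesis
    by (simp add: subst_eq_eval_mpoly eval_mpoly_const ring_hom_fun_const)
qed

lemmas subst_simps = hom_simps[OF ring_hom_fun_subst] subst_of_var

section \<open>Homogeneity\<close>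

lemma eval_mpoly_homogeneous:
  assumes "homogeneous d p"
  shows "eval_mpoly h (\<lambda>i. s * f i) p = s ^ d * eval_mpoly h f p"
proof -
  have "(\<Prod>i\<in>UNIV. (s * f i) ^ Poly_Mapping.lookup m i) =
      s ^ d * (\<Prod>i\<in>UNIV. f i ^ Poly_Mapping.lookup m i)" if "m \<in> Poly_Mapping.keys p" for m
    using assms that
    by (simp add: power_mult_distrib prod.distrib homogeneous_def monom_degree_def power_sum[symmetric])
  then show ?thesis
    by (simp add: eval_mpoly_def sum_distrib_left mult.left_commute)
qed

lemma subst_homogeneous:
  "homogeneous d p \<Longrightarrow> subst (\<lambda>i. s * f i) p = s ^ d * subst f p"
  by (simp add: subst_eq_eval_mpoly eval_mpoly_homogeneous)

lemma homogeneous_var: "homogeneous 1 (var i)"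
proof -
  have "(\<Sum>j\<in>UNIV. 1 when i = j) = (\<Sum>j\<in>UNIV. if j = i then 1 else 0 :: nat)"
    by (rule sum.cong) auto
  then show ?thesis
    by (auto simp: homogeneous_def var_def monom_degree_def lookup_single)
qed

lemma homogeneous_mult:
  assumes "homogeneous d p" "homogeneous e q"
  shows "homogeneous (d + e) (p * q)"
proof -
  have "monom_degree (a + b) = monom_degree a + monom_degree b" for a b :: "'a \<Rightarrow>\<^sub>0 nat"
    by (simp add: monom_degree_def lookup_add sum.distrib)
  then show ?thesis
    using assms keys_mult[of p q] by (fastforce simp: homogeneous_def)
qed

lemma homogeneous_add: "homogeneous d p \<Longrightarrow> homogeneous d q \<Longrightarrow> homogeneous d (p + q)"
  using Poly_Mapping.keys_add[of p q] by (fastforce simp: homogeneous_def)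

lemma homogeneous_uminus: "homogeneous d p \<Longrightarrow> homogeneous d (- p)"
  by (simp add: homogeneous_def in_keys_iff)

lemma homogeneous_diff: "homogeneous d p \<Longrightarrow> homogeneous d q \<Longrightarrow> homogeneous d (p - q)"
  using homogeneous_add[of d p "- q"] homogeneous_uminus[of d q] by simp

lemma homogeneous_zero: "homogeneous d 0"
  by (simp add: homogeneous_def)

lemma homogeneous_one: "homogeneous 0 1"
  by (simp add: homogeneous_def monom_degree_def)

lemma homogeneous_of_nat: "homogeneous 0 (of_nat n)"
  by (induction n) (simp_all add: homogeneous_zero homogeneous_one homogeneous_add)

lemma homogeneous_numeral: "homogeneous 0 (numeral n)"
  using homogeneous_of_nat[of "numeral n"] by simp

lemma homogeneous_homogeneous_component: "homogeneous d (homogeneous_component d p)"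
proof -
  have *: "homogeneous d (\<Sum>m\<in>S. Poly_Mapping.single m (Poly_Mapping.lookup p m))"
    if "\<And>m. m \<in> S \<Longrightarrow> monom_degree m = d" for S
    using that
  proof (induction S rule: infinite_finite_induct)
    case (insert m S)
    have "homogeneous d (Poly_Mapping.single m (Poly_Mapping.lookup p m))"
      using insert.prems[of m] by (simp add: homogeneous_def)
    with insert show ?case
      by (simp add: homogeneous_add)
  qed (simp_all add: homogeneous_zero)
  show ?thesis
    unfolding homogeneous_component_def by (intro *) simp
qed

lemma homogeneous_component_eq_0:
  assumes "d \<notin> monom_degree ` Poly_Mapping.keys p"
  shows "homogeneous_component d p = 0"
proof -
  have "{m \<in> Poly_Mapping.keys p. monom_degree m = d} = {}"
    using assms by auto
  then show ?thesis
    by (simp only: homogeneous_component_def sum.empty)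
qed

lemma sum_homogeneous_component:
  "(\<Sum>d\<in>monom_degree ` Poly_Mapping.keys p. homogeneous_component d p) = p"
proof -
  have "(\<Sum>d\<in>monom_degree ` Poly_Mapping.keys p. homogeneous_component d p) =
      (\<Sum>m\<in>Poly_Mapping.keys p. Poly_Mapping.single m (Poly_Mapping.lookup p m))"
    unfolding homogeneous_component_def by (rule sum.image_gen[symmetric]) simp
  then show ?thesis
    using mpoly_eq_sum_single[of p] by simp
qed

text \<open>Scaling the coordinates by \<open>X\<close> turns the grading of \<open>p\<close> into the powers of \<open>X\<close>.\<close>

lemma subst_homogeneous_component_eq_0:
  fixes p :: "('i::finite, 'k::field) mpoly" and g :: "'i \<Rightarrow> ('j::finite, 'k) mpoly"
  assumes g: "\<And>i. homogeneous e (g i)" and "e > 0" and 0: "subst g p = 0"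
  shows "subst g (homogeneous_component d p) = 0"
proof -
  define c :: "'k \<Rightarrow> ('j, 'k) mpoly poly" where "c = (\<lambda>a. [:const a:])"
  have c: "ring_hom_fun c"
    unfolding c_def by (intro ring_hom_fun_const_poly ring_hom_fun_const)
  let ?X = "[:0, 1:] :: ('j, 'k) mpoly poly"
  let ?H = "eval_mpoly c (\<lambda>i. ?X ^ e * [:g i:])"
  have lift: "eval_mpoly c (\<lambda>i. [:g i:]) q = [:subst g q:]" for q
    using hom_eval_mpoly[OF ring_hom_fun_const_poly[OF ring_hom_fun_id], of const g q]
    by (simp add: c_def subst_eq_eval_mpoly)
  have comp: "?H (homogeneous_component n p) = monom (subst g (homogeneous_component n p)) (e * n)" for n
    unfolding eval_mpoly_homogeneous[OF homogeneous_homogeneous_component] lift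
    by (simp add: power_mult[symmetric] monom_altdef)
  have var: "eval_mpoly c (\<lambda>j. [:var j:]) q = [:q:]" for q
    using hom_eval_mpoly[OF ring_hom_fun_const_poly[OF ring_hom_fun_id], of const var q]
    by (simp add: c_def subst_eq_eval_mpoly[symmetric] subst_var)
  \<comment> \<open>Because each \<open>g i\<close> is a form of degree \<open>e\<close>, the map
    \<open>?H\<close> factors through \<open>subst g\<close>, so it kills \<open>p\<close>.\<close>
  have "eval_mpoly c (\<lambda>j. ?X * [:var j:]) (g i) = ?X ^ e * [:g i:]" for i
    by (simp only: eval_mpoly_homogeneous[OF g] var)
  then have "?H p = eval_mpoly c (\<lambda>j. ?X * [:var j:]) (subst g p)"
    using hom_eval_mpoly[OF ring_hom_fun_eval_mpoly[OF c], of "\<lambda>j. ?X * [:var j:]" const g p]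
    by (simp only: subst_eq_eval_mpoly[of g] eval_mpoly_const[OF c])
  then have "?H p = 0"
    by (simp add: 0 hom_zero[OF ring_hom_fun_eval_mpoly[OF c]])
  define S where "S = monom_degree ` Poly_Mapping.keys p"
  have "finite S" by (simp add: S_def)
  have "?H (\<Sum>n\<in>S. homogeneous_component n p) =
      (\<Sum>n\<in>S. monom (subst g (homogeneous_component n p)) (e * n))"
    by (simp only: hom_sum[OF ring_hom_fun_eval_mpoly[OF c]] comp)
  then have "(\<Sum>n\<in>S. monom (subst g (homogeneous_component n p)) (e * n)) = 0"
    unfolding S_def sum_homogeneous_component \<open>?H p = 0\<close> by (rule sym)
  then have "coeff (\<Sum>n\<in>S. monom (subst g (homogeneous_component n p)) (e * n)) (e * d) = 0"
    by (simp only: coeff_0)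
  \<comment> \<open>As \<open>e > 0\<close>, the exponents \<open>e * n\<close> are distinct, and
    the coefficient at \<open>e * d\<close> isolates the component of degree
    \<open>d\<close>.\<close>
  then have "(\<Sum>n\<in>S. if n = d then subst g (homogeneous_component n p) else 0) = 0"
    using \<open>e > 0\<close> by (simp add: coeff_sum)
  then show ?thesis
    using \<open>finite S\<close> homogeneous_component_eq_0[of d p]
    by (cases "d \<in> S") (auto simp: subst_simps S_def)
qed

section \<open>Prime elements\<close>

text \<open>Coprimality without gcds: \<open>F\<close> is a nonzerodivisor modulo \<open>A\<close>.
  In a domain this is symmetric for nonzero \<open>A\<close>, which is what is shown here.\<close>

lemma dvd_cancel_of_coprime:
  fixes A F :: "'r::idom"
  assumes "\<And>b. A dvd F * b \<Longrightarrow> A dvd b" "A \<noteq> 0" "F dvd A * a"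
  shows "F dvd a"
proof -
  obtain b where b: "A * a = F * b"
    using assms(3) by (auto simp: dvd_def)
  then obtain b' where "b = A * b'"
    using assms(1)[of b] by (metis dvd_triv_left dvd_def)
  with b \<open>A \<noteq> 0\<close> have "a = F * b'"
    by simp
  then show ?thesis by simp
qed

lemma coprime_mult_left:
  fixes A A' B :: "'r::idom"
  assumes A: "\<And>c. A dvd B * c \<Longrightarrow> A dvd c" and A': "\<And>c. A' dvd B * c \<Longrightarrow> A' dvd c"
    and "A \<noteq> 0" "A * A' dvd B * c"
  shows "A * A' dvd c"
proof -
  have "A dvd c"
    using A dvd_mult_left[OF assms(4)] .
  then obtain d where d: "c = A * d" by (auto simp: dvd_def)
  then have "A' dvd B * d"
    using assms(3,4) by (simp add: mult.left_commute)
  with A'[of d] d show ?thesis by simp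
qed

text \<open>Gauss's lemma for linear polynomials: \<open>R\<close> need not be factorial, and the hypothesis expresses that
  \<open>A\<close> and \<open>B\<close> have no common factor.\<close>

lemma prime_elem_linear_poly:
  fixes A B :: "'r::idom"
  assumes "A \<noteq> 0" and coprime: "\<And>c. A dvd B * c \<Longrightarrow> A dvd c"
  shows "prime_elem [:B, A:]"
proof -
  let ?L = "[:B, A:]"
  have "?L \<noteq> 0" using \<open>A \<noteq> 0\<close> by simp
  have cancel: "?L dvd f" if "?L dvd smult (A ^ n) f" for f n
    using that
  proof (induction n arbitrary: f)
    case (Suc n)
    have "?L dvd [:A:] * smult (A ^ n) f"
      using Suc.prems by (simp add: mult.commute)
    moreover have "[:A:] dvd b" if "[:A:] dvd ?L * b" for b
    proof -
      \<comment> \<open>Proceed from the lowest coefficient upwards: coefficient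
        \<open>Suc i\<close> of \<open>?L * b\<close> is \<open>B * coeff b (Suc i)\<close> plus a
        multiple of \<open>A\<close>.\<close>
      have "A dvd coeff b i" for i
      proof (induction i)
        case 0
        have "A dvd coeff (?L * b) 0"
          using that unfolding const_poly_dvd_iff by blast
        then have "A dvd B * coeff b 0" by simp
        then show ?case by (rule coprime)
      next
        case (Suc i)
        have "A dvd coeff (?L * b) (Suc i)"
          using that unfolding const_poly_dvd_iff by blast
        then have "A dvd B * coeff b (Suc i) + A * coeff b i"
          by simp
        then have "A dvd B * coeff b (Suc i)"
          by (metis dvd_add_times_triv_right_iff mult.commute)
        then show ?case by (rule coprime)
      qed
      then show ?thesis by (simp add: const_poly_dvd_iff)
    qed
    moreover have "[:A:] \<noteq> 0" using \<open>A \<noteq> 0\<close> by simp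
    ultimately have "?L dvd smult (A ^ n) f"
      using dvd_cancel_of_coprime by blast
    then show ?case by (rule Suc.IH)
  qed simp
  \<comment> \<open>Pseudo-division by \<open>?L\<close>: multiplying by a power of its leading
    coefficient \<open>A\<close> makes division with constant remainder possible.\<close>
  have reduce: "\<exists>n r s. smult (A ^ n) f = ?L * s + [:r:]" for f
  proof (induction f)
    case 0
    have "smult (A ^ 0) 0 = ?L * 0 + [:0:]" by simp
    then show ?case by blast
  next
    case (pCons a f)
    then obtain n r s where *: "smult (A ^ n) f = ?L * s + [:r:]" by blast
    have "smult (A ^ Suc n) (pCons a f) = [:A ^ Suc n * a:] + smult A (pCons 0 (smult (A ^ n) f))"
      by simp
    also have "smult A (pCons 0 (smult (A ^ n) f)) = ?L * smult A (pCons 0 s) + [:0, A * r:]"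
      unfolding * by (simp add: smult_add_right mult.commute)
    also have "[:0, A * r:] = ?L * [:r:] + [:- (B * r):]"
      by (simp add: mult.commute)
    finally have "smult (A ^ Suc n) (pCons a f) =
        ?L * (smult A (pCons 0 s) + [:r:]) + [:A ^ Suc n * a - B * r:]"
      unfolding distrib_left by simp
    then show ?case by blast
  qed
  show ?thesis
  proof (rule prime_elemI)
    show "?L \<noteq> 0" by fact
    show "\<not> ?L dvd 1"
      using dvd_imp_degree_le[of ?L 1] \<open>A \<noteq> 0\<close> by auto
  next
    fix f g assume fg: "?L dvd f * g"
    obtain m r s where f: "smult (A ^ m) f = ?L * s + [:r:]" using reduce by blast
    obtain n r' s' where g: "smult (A ^ n) g = ?L * s' + [:r':]" using reduce by blast
    have "smult (A ^ (m + n)) (f * g) = smult (A ^ m) f * smult (A ^ n) g"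
      by (simp add: power_add mult.commute)
    also have "\<dots> = ?L * s * smult (A ^ n) g + [:r:] * smult (A ^ n) g"
      unfolding f distrib_right ..
    also have "[:r:] * smult (A ^ n) g = ?L * (s' * [:r:]) + [:r * r':]"
      unfolding g distrib_left by simp
    finally have "smult (A ^ (m + n)) (f * g) =
        ?L * (s * smult (A ^ n) g + s' * [:r:]) + [:r * r':]"
      unfolding distrib_left mult.assoc add.assoc .
    then have "?L dvd ?L * (s * smult (A ^ n) g + s' * [:r:]) + [:r * r':]"
      using fg by (metis dvd_smult)
    then have "?L dvd [:r * r':]"
      by (simp only: dvd_add_right_iff[OF dvd_triv_left])
    \<comment> \<open>\<open>?L\<close> has degree 1, so a constant that it divides is zero.\<close>
    then have "r * r' = 0"
      using dvd_imp_degree_le[of ?L "[:r * r':]"] \<open>A \<noteq> 0\<close> by auto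
    then show "?L dvd f \<or> ?L dvd g"
      unfolding mult_eq_0_iff
    proof
      assume "r = 0"
      then have "smult (A ^ m) f = ?L * s"
        using f by (simp only: pCons_0_0 add_0_right)
      then have "?L dvd smult (A ^ m) f" by (rule dvdI)
      then show ?thesis using cancel by blast
    next
      assume "r' = 0"
      then have "smult (A ^ n) g = ?L * s'"
        using g by (simp only: pCons_0_0 add_0_right)
      then have "?L dvd smult (A ^ n) g" by (rule dvdI)
      then show ?thesis using cancel by blast
    qed
  qed
qed

text \<open>Strip leading terms of \<open>b\<close>: the leading coefficient of \<open>f * b\<close>
  is the product of the two leading coefficients, so \<open>a\<close> divides that of
  \<open>b\<close>, and the rest has smaller degree.\<close>

lemma const_dvd_poly_mult_cancel:
  fixes f b :: "'r::idom poly"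
  assumes lc: "\<And>c. a dvd lead_coeff f * c \<Longrightarrow> a dvd c" and "[:a:] dvd f * b"
  shows "[:a:] dvd b"
  using assms(2)
proof (induction "degree b" arbitrary: b rule: less_induct)
  case less
  have "a dvd lead_coeff (f * b)"
    using less.prems unfolding const_poly_dvd_iff by blast
  then have "a dvd lead_coeff f * lead_coeff b"
    by (simp add: lead_coeff_mult)
  then have "a dvd lead_coeff b" by (rule lc)
  then have top: "[:a:] dvd monom (lead_coeff b) (degree b)"
    by (simp add: const_poly_dvd_iff)
  define r where "r = b - monom (lead_coeff b) (degree b)"
  have "[:a:] dvd f * r"
    unfolding r_def right_diff_distrib by (rule dvd_diff[OF less.prems dvd_mult[OF top]])
  show ?case
  proof (cases "degree b = 0")
    case True
    then obtain c where "b = [:c:]" by (rule degree_eq_zeroE)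
    with top show ?thesis by (simp add: monom_0)
  next
    case False
    have "coeff r i = 0" if "i \<ge> degree b" for i
      using that by (cases "i = degree b") (simp_all add: r_def coeff_eq_0)
    then have "degree r < degree b"
      using False by (metis leading_coeff_0_iff degree_0 not_le neq0_conv)
    then have "[:a:] dvd r"
      using less.hyps \<open>[:a:] dvd f * r\<close> by blast
    then have "[:a:] dvd r + monom (lead_coeff b) (degree b)"
      using top by (rule dvd_add)
    then show ?thesis by (simp add: r_def)
  qed
qed

text \<open>The coefficients stay in the full polynomial ring, which avoids a second index type.
  Evaluating at \<open>var i\<close> is then a left inverse, so divisibility is reflected.\<close>

definition poly_in_var ::
    "'i::finite \<Rightarrow> ('i, 'k::comm_ring_1) mpoly \<Rightarrow> ('i, 'k) mpoly poly" where
  "poly_in_var i = eval_mpoly (\<lambda>c. [:const c:]) (\<lambda>j. if j = i then [:0, 1:] else [:var j:])"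

lemma ring_hom_fun_poly_in_var: "ring_hom_fun (poly_in_var i)"
  unfolding poly_in_var_def
  by (intro ring_hom_fun_eval_mpoly ring_hom_fun_const_poly ring_hom_fun_const)

lemma poly_in_var_var: "poly_in_var i (var j) = (if j = i then [:0, 1:] else [:var j:])"
  unfolding poly_in_var_def
  by (rule eval_mpoly_var[OF ring_hom_fun_const_poly[OF ring_hom_fun_const]])

lemmas poly_in_var_simps = hom_simps[OF ring_hom_fun_poly_in_var] poly_in_var_var

lemma poly_poly_in_var: "poly (poly_in_var i p) (var i) = p"
proof -
  have "poly (poly_in_var i p) (var i) =
      eval_mpoly const (\<lambda>j. poly (if j = i then [:0, 1:] else [:var j:]) (var i)) p"
    unfolding poly_in_var_def by (subst hom_eval_mpoly[OF ring_hom_fun_poly]) simp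
  also have "\<dots> = subst var p"
    unfolding subst_eq_eval_mpoly by (intro arg_cong[of _ _ "\<lambda>f. eval_mpoly const f p"]) auto
  finally show ?thesis by (simp add: subst_var)
qed

lemma poly_in_var_dvd_iff: "poly_in_var i p dvd poly_in_var i q \<longleftrightarrow> p dvd q"
  using hom_dvd[OF ring_hom_fun_poly, of "poly_in_var i p" "poly_in_var i q" "var i"]
    hom_dvd[OF ring_hom_fun_poly_in_var, of p q i]
  by (auto simp: poly_poly_in_var)

text \<open>The first two hypotheses express that \<open>A\<close> and \<open>B\<close> do not
  involve \<open>var i\<close>. Primality descends from the univariate ring because
  \<open>poly_in_var i\<close> preserves and reflects divisibility.\<close>

lemma prime_elem_linear:
  fixes A B :: "('i::{finite,linorder}, 'k::field) mpoly"
  assumes "poly_in_var i A = [:A:]" "poly_in_var i B = [:B:]"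
    and "A \<noteq> 0" "\<And>c. A dvd B * c \<Longrightarrow> A dvd c"
  shows "prime_elem (A * var i + B)"
proof -
  have L: "poly_in_var i (A * var i + B) = [:B, A:]"
    by (simp add: poly_in_var_simps assms)
  have prime: "prime_elem [:B, A:]"
    using assms(3,4) by (rule prime_elem_linear_poly)
  show ?thesis
  proof (rule prime_elemI)
    show "A * var i + B \<noteq> 0"
      using L \<open>A \<noteq> 0\<close> by (auto simp: hom_zero[OF ring_hom_fun_poly_in_var])
    show "\<not> A * var i + B dvd 1"
      using prime_elem_not_unit[OF prime] poly_in_var_dvd_iff[of i "A * var i + B" 1]
      by (simp only: L hom_one[OF ring_hom_fun_poly_in_var] simp_thms)
    show "A * var i + B dvd p \<or> A * var i + B dvd q" if "A * var i + B dvd p * q" for p q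
    proof -
      have "[:B, A:] dvd poly_in_var i p * poly_in_var i q"
        using hom_dvd[OF ring_hom_fun_poly_in_var that, of i]
        by (simp only: L hom_mult[OF ring_hom_fun_poly_in_var])
      then show ?thesis
        using prime_elem_dvd_multD[OF prime] poly_in_var_dvd_iff[of i "A * var i + B"]
        unfolding L by blast
    qed
  qed
qed

text \<open>\<open>subst f\<close> kills \<open>L\<close> and is the identity modulo
  \<open>L\<close>, so its kernel is exactly the ideal of \<open>L\<close>; a kernel of a
  homomorphism to a domain is prime.\<close>

lemma prime_elem_kernel_subst:
  fixes L :: "('i::{finite,linorder}, 'k::field) mpoly"
  assumes "L \<noteq> 0" "subst f L = 0" "\<And>j. L dvd f j - var j"
  shows "prime_elem L"
proof -
  have dvd_iff: "L dvd p \<longleftrightarrow> subst f p = 0" for p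
  proof
    assume "L dvd p"
    then show "subst f p = 0"
      using assms(2) hom_dvd[OF ring_hom_fun_subst, of L p f] by simp
  next
    assume "subst f p = 0"
    moreover have "L dvd subst f p - subst var p"
      unfolding subst_eq_eval_mpoly by (intro eval_mpoly_dvd_diff ring_hom_fun_const assms)
    ultimately show "L dvd p" by (simp add: subst_var)
  qed
  show ?thesis
    using \<open>L \<noteq> 0\<close> by (auto simp: prime_elem_def dvd_iff subst_simps)
qed

lemma not_dvd_if_eval_mpoly:
  assumes "ring_hom_fun h" "eval_mpoly h f L = 0" "eval_mpoly h f p \<noteq> 0"
  shows "\<not> L dvd p"
  using assms hom_dvd[OF ring_hom_fun_eval_mpoly, of h L p f] by auto

section \<open>Coordinates\<close>

definition tuple4 :: "'a \<Rightarrow> 'a \<Rightarrow> 'a \<Rightarrow> 'a \<Rightarrow> 4 \<Rightarrow> 'a" where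
  "tuple4 a b c d i = (if i = 0 then a else if i = 1 then b else if i = 2 then c else d)"

definition tuple5 :: "'a \<Rightarrow> 'a \<Rightarrow> 'a \<Rightarrow> 'a \<Rightarrow> 'a \<Rightarrow> 5 \<Rightarrow> 'a" where
  "tuple5 a b c d e i =
     (if i = 0 then a else if i = 1 then b else if i = 2 then c else if i = 3 then d else e)"

definition tuple6 :: "'a \<Rightarrow> 'a \<Rightarrow> 'a \<Rightarrow> 'a \<Rightarrow> 'a \<Rightarrow> 'a \<Rightarrow> 6 \<Rightarrow> 'a" where
  "tuple6 a b c d e f i =
     (if i = 0 then a else if i = 1 then b else if i = 2 then c else if i = 3 then d
      else if i = 4 then e else f)"

lemma tuple4_simps [simp]:
  "tuple4 a b c d 0 = a" "tuple4 a b c d 1 = b" "tuple4 a b c d 2 = c" "tuple4 a b c d 3 = d"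
  by (simp_all add: tuple4_def)

lemma tuple5_simps [simp]:
  "tuple5 a b c d e 0 = a" "tuple5 a b c d e 1 = b" "tuple5 a b c d e 2 = c"
  "tuple5 a b c d e 3 = d" "tuple5 a b c d e 4 = e"
  by (simp_all add: tuple5_def)

lemma tuple6_simps [simp]:
  "tuple6 a b c d e f 0 = a" "tuple6 a b c d e f 1 = b" "tuple6 a b c d e f 2 = c"
  "tuple6 a b c d e f 3 = d" "tuple6 a b c d e f 4 = e" "tuple6 a b c d e f 5 = f"
  by (simp_all add: tuple6_def)

lemma forall_4: "(\<forall>i::4. P i) \<longleftrightarrow> P 0 \<and> P 1 \<and> P 2 \<and> P 3"
proof (intro iffI allI)
  fix i :: 4
  assume "P 0 \<and> P 1 \<and> P 2 \<and> P 3"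
  then show "P i"
  proof (cases i rule: bit0_cases)
    case (of_int z)
    then have "z = 0 \<or> z = 1 \<or> z = 2 \<or> z = 3" by (auto; presburger)
    with of_int \<open>P 0 \<and> _\<close> show ?thesis by auto
  qed
qed auto

lemma forall_5: "(\<forall>i::5. P i) \<longleftrightarrow> P 0 \<and> P 1 \<and> P 2 \<and> P 3 \<and> P 4"
proof (intro iffI allI)
  fix i :: 5
  assume "P 0 \<and> P 1 \<and> P 2 \<and> P 3 \<and> P 4"
  then show "P i"
  proof (cases i rule: bit1_cases)
    case (of_int z)
    then have "z = 0 \<or> z = 1 \<or> z = 2 \<or> z = 3 \<or> z = 4" by (auto; presburger)
    with of_int \<open>P 0 \<and> _\<close> show ?thesis by auto
  qed
qed auto

section \<open>The inverse map\<close>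

text \<open>This and the following formulas are taken over any commutative ring, so that each
  identity is expanded once and then used for variables, polynomials and images under
  homomorphisms.\<close>

definition burk :: "(5 \<Rightarrow> 'r::comm_ring_1) \<Rightarrow> 'r" where
  "burk y = y 0 * (y 0 ^ 3 + y 1 ^ 3 + y 2 ^ 3 + y 3 ^ 3 + y 4 ^ 3) + 3 * y 1 * y 2 * y 3 * y 4"

definition quad :: "'r::comm_ring_1 \<Rightarrow> 'r \<Rightarrow> 'r" where
  "quad a b = a ^ 2 - a * b + b ^ 2"

definition psi :: "(5 \<Rightarrow> 'r::comm_ring_1) \<Rightarrow> 4 \<Rightarrow> 'r" where
  "psi y = tuple4
     (y 0 * quad (y 0) (y 1))
     (y 0 * (y 1 * y 2 - y 0 * y 3 - y 0 * y 4))
     (y 0 * (y 0 * y 2 - y 1 * y 2 + y 1 * y 3 + y 1 * y 4))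
     (y 0 * y 1 * y 2 - y 0 * y 1 * y 3 + y 1 ^ 2 * y 3 - y 0 ^ 2 * y 4)"

text \<open>
  The closure of the fibre of \<open>psi\<close>, as a map on the whole of projective 4-space, over \<open>t\<close> is a line,
  parametrised here by \<open>(u : v) = (y\<^sub>1 : y\<^sub>0)\<close>.  On it the quartic form acquires the factor
  \<open>t\<^sub>0 v (v\<^sup>2 - u v + u\<^sup>2)\<close>, and the remaining linear factor \<open>den t * u - num t * v\<close> gives the inverse.
\<close>

definition fibre_line :: "(4 \<Rightarrow> 'r::comm_ring_1) \<Rightarrow> 'r \<Rightarrow> 'r \<Rightarrow> 5 \<Rightarrow> 'r" where
  "fibre_line t u v = tuple5 (t 0 * v) (t 0 * u) (t 1 * u + t 2 * v) ((t 3 - t 1) * v)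
     ((t 1 + t 2) * u - t 3 * v)"

definition den :: "(4 \<Rightarrow> 'r::comm_ring_1) \<Rightarrow> 'r" where
  "den t = t 0 ^ 3 + t 1 ^ 3 + (t 1 + t 2) ^ 3 + 3 * t 1 * (t 3 - t 1) * (t 1 + t 2)"

definition num :: "(4 \<Rightarrow> 'r::comm_ring_1) \<Rightarrow> 'r" where
  "num t = t 3 ^ 3 - t 0 ^ 3 - t 2 ^ 3 - (t 3 - t 1) ^ 3"

definition psi_inv :: "(4 \<Rightarrow> 'r::comm_ring_1) \<Rightarrow> 5 \<Rightarrow> 'r" where
  "psi_inv t = fibre_line t (num t) (den t)"

lemma burk_fibre_line:
  "burk (fibre_line t u v) = t 0 * v * quad v u * (den t * u - num t * v)"
  unfolding burk_def fibre_line_def quad_def den_def num_def tuple5_simps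
  by (simp add: algebra_simps power2_eq_square power3_eq_cube)

lemma burk_psi_inv: "burk (psi_inv t) = 0"
  by (simp add: psi_inv_def burk_fibre_line mult.commute)

lemma psi_fibre_line: "psi (fibre_line t u v) i = t 0 ^ 2 * v * quad v u * t i"
proof -
  have "\<forall>i. psi (fibre_line t u v) i = t 0 ^ 2 * v * quad v u * t i"
    unfolding forall_4 psi_def fibre_line_def quad_def
    by (simp add: algebra_simps power2_eq_square)
  then show ?thesis by blast
qed

text \<open>Projectively, \<open>y\<close> is the point with parameter \<open>(y 1 : y 0)\<close> on
  the fibre line through it. This recovers a form from its restrictions to the fibre lines.\<close>

lemma fibre_line_psi: "fibre_line (psi y) (y 1) (y 0) i = y 0 * quad (y 0) (y 1) * y i"
proof -
  have "\<forall>i. fibre_line (psi y) (y 1) (y 0) i = y 0 * quad (y 0) (y 1) * y i"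
    unfolding forall_5 psi_def fibre_line_def quad_def
    by (simp add: algebra_simps power2_eq_square)
  then show ?thesis by blast
qed

lemma burk_scale: "burk (\<lambda>i. s * y i) = s ^ 4 * burk y"
  by (simp add: burk_def algebra_simps power2_eq_square power3_eq_cube power4_eq_xxxx)

text \<open>Evaluate the quartic on the fibre line through \<open>y\<close> in two ways, by
  \<open>fibre_line_psi\<close> with homogeneity and by \<open>burk_fibre_line\<close>, and cancel.
  This avoids an expansion in degree 10.\<close>

lemma den_num_psi:
  fixes y :: "5 \<Rightarrow> 'r::idom"
  assumes "y 0 \<noteq> 0" "quad (y 0) (y 1) \<noteq> 0"
  shows "den (psi y) * y 1 - num (psi y) * y 0 = (y 0 * quad (y 0) (y 1)) ^ 2 * burk y"
proof -
  let ?q = "quad (y 0) (y 1)"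
  have "burk (fibre_line (psi y) (y 1) (y 0)) = (y 0 * ?q) ^ 4 * burk y"
    using burk_scale[of "y 0 * ?q" y] by (simp add: fibre_line_psi[abs_def])
  moreover have "burk (fibre_line (psi y) (y 1) (y 0)) =
      (y 0 * ?q) ^ 2 * (den (psi y) * y 1 - num (psi y) * y 0)"
    by (simp add: burk_fibre_line psi_def power2_eq_square)
  ultimately have "(y 0 * ?q) ^ 2 * (den (psi y) * y 1 - num (psi y) * y 0) =
      (y 0 * ?q) ^ 2 * ((y 0 * ?q) ^ 2 * burk y)"
    by (simp add: power_add[symmetric] mult.assoc[symmetric])
  moreover have "(y 0 * ?q) ^ 2 \<noteq> 0" using assms by simp
  ultimately show ?thesis by (simp only: mult_cancel_left simp_thms)
qed

context
  fixes h :: "'a::comm_ring_1 \<Rightarrow> 'b::comm_ring_1"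
  assumes h: "ring_hom_fun h"
begin

lemma hom_burk: "h (burk y) = burk (\<lambda>i. h (y i))"
  by (simp add: burk_def hom_simps[OF h])

lemma hom_quad: "h (quad a b) = quad (h a) (h b)"
  by (simp add: quad_def hom_simps[OF h])

lemma hom_den: "h (den t) = den (\<lambda>i. h (t i))"
  by (simp add: den_def hom_simps[OF h])

lemma hom_num: "h (num t) = num (\<lambda>i. h (t i))"
  by (simp add: num_def hom_simps[OF h])

lemma hom_fibre_line: "h (fibre_line t u v i) = fibre_line (\<lambda>i. h (t i)) (h u) (h v) i"
  by (simp add: fibre_line_def tuple5_def hom_simps[OF h])

lemma hom_psi_inv: "h (psi_inv t i) = psi_inv (\<lambda>i. h (t i)) i"
  by (simp add: psi_inv_def hom_fibre_line hom_num hom_den)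

lemma hom_psi: "h (psi y i) = psi (\<lambda>i. h (y i)) i"
  by (simp add: psi_def tuple4_def hom_quad hom_simps[OF h])

end

section \<open>The given forms, the characteristic, and degrees\<close>

lemma burkhardt_form_eq: "burkhardt_form = burk var"
  by (simp add: burkhardt_form_def burk_def)

lemma burkhardt_psi_eq: "burkhardt_psi = psi var"
proof -
  have "\<forall>j. burkhardt_psi j = psi var j"
    unfolding forall_4 by (simp add: burkhardt_psi_def psi_def quad_def Let_def)
  then show ?thesis by (simp add: fun_eq_iff)
qed

lemma three_neq_0:
  assumes "CHAR('k::field) \<noteq> 3"
  shows "(3 :: 'k) \<noteq> 0"
proof
  assume "(3 :: 'k) = 0"
  then have "of_nat 3 = (0 :: 'k)" by simp
  then have "CHAR('k) dvd 3" by (simp only: of_nat_eq_0_iff_char_dvd)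
  moreover have "CHAR('k) \<noteq> 1" by simp
  moreover have "prime (3 :: nat)" by simp
  ultimately show False using assms by (metis prime_nat_iff)
qed

lemma homogeneous_psi_inv: "homogeneous 4 (psi_inv var i)"
proof -
  have h3: "homogeneous 3 (a * b * c)" if "homogeneous 1 a" "homogeneous 1 b" "homogeneous 1 c"
    for a b c :: "(4, 'a) mpoly"
    using homogeneous_mult[OF homogeneous_mult[OF that(1,2)] that(3)] by (simp add: numeral_eq_Suc)
  have h4: "homogeneous 4 (a * b)" if "homogeneous 1 a" "homogeneous 3 b" for a b :: "(4, 'a) mpoly"
    using homogeneous_mult[OF that] by simp
  have h3': "homogeneous 3 (3 * a)" if "homogeneous 3 a" for a :: "(4, 'a) mpoly"
    using homogeneous_mult[OF homogeneous_numeral that] by simp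
  note intros = homogeneous_add homogeneous_diff h3 h3' homogeneous_var
  have "homogeneous 3 (num (var :: 4 \<Rightarrow> (4, 'a) mpoly))"
    unfolding num_def power3_eq_cube by (intro intros)
  moreover have "homogeneous 3 (den (var :: 4 \<Rightarrow> (4, 'a) mpoly))"
    unfolding den_def power3_eq_cube mult.assoc[of 3] by (intro intros)
  ultimately have "\<forall>i. homogeneous 4 (psi_inv (var :: 4 \<Rightarrow> (4, 'a) mpoly) i)"
    unfolding forall_5 psi_inv_def fibre_line_def tuple5_simps
    by (intro conjI homogeneous_add homogeneous_diff h4 homogeneous_var)
  then show ?thesis by blast
qed

lemma homogeneous_psi: "homogeneous 3 (psi var i)"
proof -
  have h3: "homogeneous 3 (a * b)" if "homogeneous 1 a" "homogeneous 2 b" for a b :: "(5, 'a) mpoly"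
    using homogeneous_mult[OF that] by (simp only: one_plus_numeral add_One_commute BitM.simps one_add_one numeral_plus_numeral add_num_simps)
  have h2: "homogeneous 2 (a * b)" if "homogeneous 1 a" "homogeneous 1 b" for a b :: "(5, 'a) mpoly"
    using homogeneous_mult[OF that] by (simp only: one_add_one)
  have "\<forall>i. homogeneous 3 (psi (var :: 5 \<Rightarrow> (5, 'a) mpoly) i)"
    unfolding forall_4 psi_def quad_def tuple4_simps power2_eq_square mult.assoc
    by (intro conjI homogeneous_add homogeneous_diff h3 h2 homogeneous_var)
  then show ?thesis by blast
qed

lemma subst_burkhardt_form: "subst f burkhardt_form = burk f"
  by (simp add: burkhardt_form_eq hom_burk[OF ring_hom_fun_subst] subst_of_var)

lemma subst_psi: "subst f (psi var i) = psi f i"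
  by (simp add: hom_psi[OF ring_hom_fun_subst] subst_of_var)

lemma subst_psi_inv: "subst f (psi_inv var i) = psi_inv f i"
  by (simp add: hom_psi_inv[OF ring_hom_fun_subst] subst_of_var)

section \<open>Test points and prime linear forms\<close>

abbreviation (input) eval_point :: "('i::finite \<Rightarrow> 'k::field) \<Rightarrow> ('i, 'k) mpoly \<Rightarrow> 'k" where
  "eval_point \<equiv> eval_mpoly (\<lambda>c. c)"

lemmas eval_point_simps =
  hom_simps[OF ring_hom_fun_eval_mpoly[OF ring_hom_fun_id]] eval_mpoly_var[OF ring_hom_fun_id]
lemmas not_dvd_point = not_dvd_if_eval_mpoly[OF ring_hom_fun_id]

lemma neq_0_point: "eval_point f p \<noteq> 0 \<Longrightarrow> p \<noteq> 0"
  using hom_zero[OF ring_hom_fun_eval_mpoly[OF ring_hom_fun_id]] by auto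

lemma var_neq_0: "var i \<noteq> (0 :: ('i::finite, 'k::field) mpoly)"
  by (rule neq_0_point[where f = "\<lambda>_. 1"]) (simp add: eval_point_simps)

lemma prime_elem_var: "prime_elem (var i :: ('i::{finite,linorder}, 'k::field) mpoly)"
  by (rule prime_elem_kernel_subst[where f = "\<lambda>j. if j = i then 0 else var j"])
    (auto simp: var_neq_0 subst_of_var)

lemma prime_elem_var_add_var:
  assumes "i \<noteq> j"
  shows "prime_elem (var i + var j :: ('i::{finite,linorder}, 'k::field) mpoly)"
proof (rule prime_elem_kernel_subst[where f = "\<lambda>l. if l = j then - var i else var l"])
  show "var i + var j \<noteq> (0 :: ('i, 'k) mpoly)"
    by (rule neq_0_point[where f = "\<lambda>l. if l = i then 1 else 0"])
      (use assms in \<open>simp add: eval_point_simps\<close>)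
  show "var i + var j dvd (if l = j then - var i else var l) - (var l :: ('i, 'k) mpoly)" for l
  proof -
    have "(if l = j then - var i else var l) - var l =
        (var i + var j :: ('i, 'k) mpoly) * (if l = j then - 1 else 0)"
      by simp
    then show ?thesis by (metis dvd_triv_left)
  qed
qed (use assms in \<open>simp add: subst_simps\<close>)

lemma prime_elem_dvd_cancel: "prime_elem p \<Longrightarrow> \<not> p dvd b \<Longrightarrow> p dvd b * c \<Longrightarrow> p dvd c"
  using prime_elem_dvd_multD by blast

section \<open>The kernel of the inverse map\<close>

text \<open>Of the six variables, \<open>var 0\<close> to \<open>var 3\<close> stand for \<open>t\<close>, \<open>var 4\<close> for \<open>v\<close> and \<open>var 5\<close> for \<open>u\<close>.\<close>

abbreviation tvars :: "4 \<Rightarrow> (6, 'k::field) mpoly" where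
  "tvars \<equiv> tuple4 (var 0) (var 1) (var 2) (var 3)"

text \<open>3 is invertible in \<open>k\<close>, hence a unit among polynomials; as a factor it is
  harmless in coprimality arguments.\<close>

lemma three_dvd:
  assumes "(3 :: 'k::field) \<noteq> 0"
  shows "(3 :: ('i::finite, 'k) mpoly) dvd a"
proof -
  have "const (3 * (1 / 3) :: 'k) = (const 3 * const (1 / 3) :: ('i, 'k) mpoly)"
    by (rule hom_mult[OF ring_hom_fun_const])
  then have "const (3 :: 'k) * const (1 / 3) = (const 1 :: ('i, 'k) mpoly)"
    using assms by simp
  then have "(3 :: ('i, 'k) mpoly) * const (1 / 3) = 1"
    by (simp add: hom_numeral[OF ring_hom_fun_const] hom_one[OF ring_hom_fun_const])
  then have "(3 :: ('i, 'k) mpoly) dvd 1"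
    by (metis dvd_triv_left)
  then show ?thesis by (rule dvd_trans) simp
qed

text \<open>\<open>den\<close> is linear in \<open>var 3\<close> with leading coefficient
  \<open>?A\<close>. In characteristic 3 that coefficient vanishes and \<open>den\<close> is a
  cube.\<close>

lemma prime_elem_den:
  assumes three: "(3 :: 'k::field) \<noteq> 0"
  shows "prime_elem (den (tvars :: 4 \<Rightarrow> (6, 'k) mpoly))"
proof -
  let ?A = "3 * var 1 * (var 1 + var 2) :: (6, 'k) mpoly"
  let ?B = "var 0 ^ 3 + var 1 ^ 3 + (var 1 + var 2) ^ 3 - 3 * var 1 ^ 2 * (var 1 + var 2) :: (6, 'k) mpoly"
  have three': "(3 :: (6, 'k) mpoly) \<noteq> 0"
    using three_dvd[OF three, of "1 :: (6, 'k) mpoly"] by auto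
  have p1: "prime_elem (var 1 :: (6, 'k) mpoly)"
    by (rule prime_elem_var)
  have p2: "prime_elem (var 1 + var 2 :: (6, 'k) mpoly)"
    by (rule prime_elem_var_add_var) simp
  \<comment> \<open>At this point both linear forms vanish while \<open>?B\<close> is 1.\<close>
  have n1: "\<not> var 1 dvd ?B" and n2: "\<not> var 1 + var 2 dvd ?B"
    by (rule not_dvd_point[where f = "tuple6 1 0 0 0 0 0"]; simp add: eval_point_simps)+
  have "?A \<noteq> 0"
    using three' prime_elem_not_zeroI[OF p2] by (simp add: var_neq_0)
  have coprime: "?A dvd c" if "?A dvd ?B * c" for c
  proof (rule coprime_mult_left[OF _ _ _ that])
    show "3 * var 1 dvd c" if "3 * var 1 dvd ?B * c" for c
      using coprime_mult_left[OF _ _ three' that] three_dvd[OF three]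
        prime_elem_dvd_cancel[OF p1 n1] by blast
    show "var 1 + var 2 dvd c" if "var 1 + var 2 dvd ?B * c" for c
      using prime_elem_dvd_cancel[OF p2 n2 that] .
    show "3 * var 1 \<noteq> (0 :: (6, 'k) mpoly)"
      using three' by (simp add: var_neq_0)
  qed
  have "poly_in_var 3 ?A = [:?A:]" "poly_in_var 3 ?B = [:?B:]"
    by (simp_all add: poly_in_var_simps numeral_poly poly_const_pow)
  then have "prime_elem (?A * var 3 + ?B)"
    using \<open>?A \<noteq> 0\<close> coprime by (rule prime_elem_linear)
  moreover have "?A * var 3 + ?B = den tvars"
    by (simp add: den_def algebra_simps power2_eq_square)
  ultimately show ?thesis by simp
qed

text \<open>The polynomial is linear in \<open>var 5\<close>, and its leading coefficient is the
  prime \<open>den\<close>, so it suffices that \<open>den\<close> does not divide the constant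
  term.\<close>

lemma prime_elem_graph:
  assumes three: "(3 :: 'k::field) \<noteq> 0"
  shows "prime_elem (den tvars * var 5 - num tvars * var 4 :: (6, 'k) mpoly)"
proof -
  let ?N = "- num tvars * var 4 :: (6, 'k) mpoly"
  \<comment> \<open>The test point is a zero of \<open>den\<close> where \<open>num\<close> is 3;
    the next one only adds \<open>v = 1\<close>.\<close>
  have "\<not> den tvars dvd num (tvars :: 4 \<Rightarrow> (6, 'k) mpoly)"
    by (rule not_dvd_point[where f = "tuple6 (-1) 1 (-1) 0 0 0"])
      (simp_all add: den_def num_def eval_point_simps three)
  moreover have "\<not> den tvars dvd (var 4 :: (6, 'k) mpoly)"
    by (rule not_dvd_point[where f = "tuple6 (-1) 1 (-1) 0 1 0"])
      (simp_all add: den_def eval_point_simps)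
  ultimately have "\<not> den tvars dvd ?N"
    using prime_elem_dvd_multD[OF prime_elem_den[OF three]] by fastforce
  note coprime = prime_elem_dvd_cancel[OF prime_elem_den[OF three] this]
  have "poly_in_var 5 (den tvars) = [:den tvars :: (6, 'k) mpoly:]" "poly_in_var 5 ?N = [:?N:]"
    by (simp_all add: den_def num_def poly_in_var_simps numeral_poly poly_const_pow)
  then have "prime_elem (den tvars * var 5 + ?N)"
    using prime_elem_not_zeroI[OF prime_elem_den[OF three]] coprime by (rule prime_elem_linear)
  then show ?thesis by simp
qed

text \<open>Both factors are coprime to the quartic. \<open>var 0\<close> is prime, but
  \<open>quad\<close> splits when \<open>k\<close> contains primitive cube roots of unity, so it is
  treated through a leading coefficient instead.\<close>

lemma burkhardt_form_dvd_cancel: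
  fixes a :: "(5, 'k::field) mpoly"
  assumes three: "(3 :: 'k) \<noteq> 0"
    and "burkhardt_form dvd (var 0 * quad (var 0) (var 1)) ^ n * a"
  shows "burkhardt_form dvd a"
proof -
  let ?q = "quad (var 0) (var 1) :: (5, 'k) mpoly"
  let ?F = "burkhardt_form :: (5, 'k) mpoly"
  have nF: "\<not> var 0 dvd ?F"
    by (rule not_dvd_point[where f = "tuple5 0 1 1 1 1"])
      (simp_all add: burkhardt_form_def eval_point_simps three)
  have nq: "\<not> var 0 dvd ?q"
    by (rule not_dvd_point[where f = "tuple5 0 1 1 1 1"]) (simp_all add: quad_def eval_point_simps)
  have y: "?F dvd a" if "?F dvd var 0 * a" for a
    using dvd_cancel_of_coprime[OF prime_elem_dvd_cancel[OF prime_elem_var nF] var_neq_0 that] .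
  have q0: "?q dvd c" if "?q dvd var 0 * c" for c
    using dvd_cancel_of_coprime[OF prime_elem_dvd_cancel[OF prime_elem_var nq] var_neq_0 that] .
  have "?q \<noteq> 0" using nq by auto
  define f where "f = poly_in_var 2 ?F"
  have f: "f = [:var 0 * (var 0 ^ 3 + var 1 ^ 3 + var 3 ^ 3 + var 4 ^ 3), 3 * var 1 * var 3 * var 4, 0, var 0:]"
    by (simp add: f_def burkhardt_form_def poly_in_var_simps numeral_poly power3_eq_cube algebra_simps)
  \<comment> \<open>\<open>?q\<close> does not involve \<open>var 2\<close> and has no factor in common with the leading coefficient \<open>var 0\<close> of \<open>f\<close>\<close>
  have "?q dvd b" if "?q dvd ?F * b" for b
  proof -
    have Q: "poly_in_var 2 ?q = [:?q:]"
      by (simp add: quad_def poly_in_var_simps power2_eq_square)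
    have "[:?q:] dvd f * poly_in_var 2 b"
      using hom_dvd[OF ring_hom_fun_poly_in_var that, of 2]
      by (simp only: Q f_def hom_mult[OF ring_hom_fun_poly_in_var])
    moreover have "?q dvd c" if "?q dvd lead_coeff f * c" for c
    proof (rule q0)
      show "?q dvd var 0 * c" using that by (simp add: f var_neq_0)
    qed
    ultimately have "[:?q:] dvd poly_in_var 2 b"
      using const_dvd_poly_mult_cancel by blast
    then show ?thesis
      by (simp only: Q[symmetric] poly_in_var_dvd_iff)
  qed
  then have q: "?F dvd a" if "?F dvd ?q * a" for a
    using dvd_cancel_of_coprime[OF _ \<open>?q \<noteq> 0\<close> that] by blast
  show ?thesis
    using assms(2)
  proof (induction n)
    case (Suc n)
    then have "?F dvd var 0 * (?q * ((var 0 * ?q) ^ n * a))"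
      by (simp add: mult.assoc)
    then have "?F dvd ?q * ((var 0 * ?q) ^ n * a)" by (rule y)
    then have "?F dvd (var 0 * ?q) ^ n * a" by (rule q)
    then show ?case by (rule Suc.IH)
  qed simp
qed

lemma burkhardt_form_dvd_if_homogeneous:
  fixes p :: "(5, 'k::field) mpoly"
  assumes three: "(3 :: 'k) \<noteq> 0" and p: "homogeneous e p" and 0: "subst (psi_inv var) p = 0"
  shows "burkhardt_form dvd p"
proof -
  let ?t = "tvars :: 4 \<Rightarrow> (6, 'k) mpoly" and ?u = "var 5 :: (6, 'k) mpoly" and ?v = "var 4 :: (6, 'k) mpoly"
  let ?P = "subst (fibre_line ?t ?u ?v) p"
  define L where "L = den ?t * ?u - num ?t * ?v"
  \<comment> \<open>\<open>fibre_line\<close> is linear in \<open>(u, v)\<close>, so each difference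
    is \<open>L\<close> times the coefficient of \<open>u\<close> in that coordinate.\<close>
  have "L dvd den ?t * fibre_line ?t ?u ?v i - ?v * psi_inv ?t i" for i
  proof -
    have "\<forall>i. \<exists>c. den ?t * fibre_line ?t ?u ?v i - ?v * psi_inv ?t i = L * c"
      unfolding forall_5 psi_inv_def fibre_line_def tuple5_simps
    proof (intro conjI exI)
      show "den ?t * (?t 0 * ?v) - ?v * (?t 0 * den ?t) = L * 0" by (simp add: algebra_simps)
      show "den ?t * (?t 0 * ?u) - ?v * (?t 0 * num ?t) = L * ?t 0"
        by (simp add: L_def algebra_simps)
      show "den ?t * (?t 1 * ?u + ?t 2 * ?v) - ?v * (?t 1 * num ?t + ?t 2 * den ?t) = L * ?t 1"
        by (simp add: L_def algebra_simps)
      show "den ?t * ((?t 3 - ?t 1) * ?v) - ?v * ((?t 3 - ?t 1) * den ?t) = L * 0"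
        by (simp add: algebra_simps)
      show "den ?t * ((?t 1 + ?t 2) * ?u - ?t 3 * ?v) -
          ?v * ((?t 1 + ?t 2) * num ?t - ?t 3 * den ?t) = L * (?t 1 + ?t 2)"
        by (simp add: L_def algebra_simps)
    qed
    then show ?thesis by (metis dvd_triv_left)
  qed
  then have "L dvd subst (\<lambda>i. den ?t * fibre_line ?t ?u ?v i) p - subst (\<lambda>i. ?v * psi_inv ?t i) p"
    unfolding subst_eq_eval_mpoly by (rule eval_mpoly_dvd_diff[OF ring_hom_fun_const])
  moreover have "subst (psi_inv ?t) p = 0"
    using arg_cong[OF 0, of "subst ?t"] by (simp add: subst_subst subst_psi_inv subst_simps)
  \<comment> \<open>Homogeneity turns the scalar factors of the two points into \<open>e\<close>-th
    powers, and the second term is zero.\<close>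
  ultimately have "L dvd den ?t ^ e * ?P"
    by (simp add: subst_homogeneous[OF p])
  moreover have "prime_elem L"
    unfolding L_def by (rule prime_elem_graph[OF three])
  \<comment> \<open>At \<open>t = (1, 0, 0, 0)\<close> one has \<open>den = 1\<close> and
    \<open>num = -1\<close>, so \<open>u = -1\<close>, \<open>v = 1\<close> gives a zero of
    \<open>L\<close>.\<close>
  moreover have "\<not> L dvd den ?t"
    by (rule not_dvd_point[where f = "tuple6 1 0 0 0 1 (-1)"])
      (simp_all add: L_def den_def num_def eval_point_simps)
  ultimately have "L dvd ?P"
    using prime_elem_dvd_multD prime_elem_dvd_power by blast
  let ?y = "var :: 5 \<Rightarrow> (5, 'k) mpoly" and ?q = "quad (var 0) (var 1) :: (5, 'k) mpoly"
  \<comment> \<open>Specialise \<open>t\<close> to \<open>psi y\<close>, \<open>v\<close> to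
    \<open>y 0\<close> and \<open>u\<close> to \<open>y 1\<close>: then \<open>?P\<close> becomes a
    multiple of \<open>p\<close>, and \<open>L\<close> a multiple of the quartic by
    \<open>den_num_psi\<close>.\<close>
  let ?s = "tuple6 (psi ?y 0) (psi ?y 1) (psi ?y 2) (psi ?y 3) (?y 0) (?y 1)"
  have t: "subst ?s (?t i) = psi ?y i" for i
  proof -
    have "\<forall>i. subst ?s (?t i) = psi ?y i"
      unfolding forall_4 by (simp add: subst_of_var)
    then show ?thesis by blast
  qed
  have "subst ?s ?P = subst (\<lambda>i. ?y 0 * ?q * ?y i) p"
    by (simp add: subst_subst hom_fibre_line[OF ring_hom_fun_subst] t subst_of_var fibre_line_psi)
  also have "\<dots> = (?y 0 * ?q) ^ e * p"
    by (simp add: subst_homogeneous[OF p] subst_var)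
  finally have "subst ?s L dvd (?y 0 * ?q) ^ e * p"
    using hom_dvd[OF ring_hom_fun_subst \<open>L dvd ?P\<close>, of ?s] by simp
  moreover have "?q \<noteq> 0"
    by (rule neq_0_point[where f = "tuple5 1 0 0 0 0"]) (simp add: quad_def eval_point_simps)
  then have "subst ?s L = (?y 0 * ?q) ^ 2 * burkhardt_form"
    by (simp add: L_def hom_simps[OF ring_hom_fun_subst] hom_den[OF ring_hom_fun_subst]
        hom_num[OF ring_hom_fun_subst] t subst_of_var den_num_psi var_neq_0 burkhardt_form_eq)
  ultimately have "burkhardt_form dvd (?y 0 * ?q) ^ e * p"
    using dvd_mult_right by auto
  then show ?thesis by (rule burkhardt_form_dvd_cancel[OF three])
qed

text \<open>The kernel is graded, so the case of forms suffices. Membership in the ideal of the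
  quartic becomes a vanishing condition in a domain.\<close>

lemma burkhardt_form_dvd_iff:
  fixes p :: "(5, 'k::field) mpoly"
  assumes "(3 :: 'k) \<noteq> 0"
  shows "burkhardt_form dvd p \<longleftrightarrow> subst (psi_inv var) p = 0"
proof
  assume "burkhardt_form dvd p"
  then show "subst (psi_inv var) p = 0"
    using hom_dvd[OF ring_hom_fun_subst, of burkhardt_form p "psi_inv var"]
    by (simp add: subst_burkhardt_form burk_psi_inv)
next
  assume "subst (psi_inv var) p = 0"
  then have "burkhardt_form dvd homogeneous_component d p" for d
    using burkhardt_form_dvd_if_homogeneous[OF assms homogeneous_homogeneous_component]
      subst_homogeneous_component_eq_0[of 4 "psi_inv var" p]
    by (simp add: homogeneous_psi_inv)
  then have "burkhardt_form dvd (\<Sum>d\<in>monom_degree ` Poly_Mapping.keys p. homogeneous_component d p)"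
    by (intro dvd_sum)
  then show "burkhardt_form dvd p"
    by (simp only: sum_homogeneous_component)
qed

section \<open>Birationality from the description of the kernel\<close>

theorem theorem2p1:
  assumes "CHAR('k::field) \<noteq> 3"
  shows "birational_map
           (hypersurface (burkhardt_form :: (5, 'k) mpoly))
           (projective_space :: (4, 'k) mpoly set)
           burkhardt_psi"
proof -
  have three: "(3 :: 'k) \<noteq> 0"
    using assms by (rule three_neq_0)
  let ?I = "hypersurface (burkhardt_form :: (5, 'k) mpoly)"
  let ?J = "projective_space :: (4, 'k) mpoly set"
  let ?g = "psi_inv (var :: 4 \<Rightarrow> (4, 'k) mpoly)"
  let ?f = "psi (var :: 5 \<Rightarrow> (5, 'k) mpoly)"
  \<comment> \<open>The factor from \<open>psi_fibre_line\<close> at \<open>u = num\<close>,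
    \<open>v = den\<close>: the scalar by which \<open>psi\<close> after its inverse multiplies the
    coordinates.\<close>
  define s where "s = var 0 ^ 2 * den var * quad (den var) (num var :: (4, 'k) mpoly)"
  have I: "p \<in> ?I \<longleftrightarrow> subst ?g p = 0" for p
    by (simp add: hypersurface_def burkhardt_form_dvd_iff[OF three])
  have J: "q \<in> ?J \<longleftrightarrow> q = 0" for q
    by (simp add: projective_space_def)
  have fg: "psi ?g i = s * var i" for i
    by (simp add: psi_inv_def psi_fibre_line s_def)
  have gf: "psi_inv (psi ?g) i = s ^ 4 * ?g i" for i
  proof -
    have "psi_inv (psi ?g) i = subst (\<lambda>i. s * var i) (?g i)"
      by (simp add: subst_psi_inv fg[abs_def])
    also have "\<dots> = s ^ 4 * subst var (?g i)"
      by (rule subst_homogeneous[OF homogeneous_psi_inv])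
    finally show ?thesis
      by (simp only: subst_var)
  qed
  \<comment> \<open>Here \<open>den = 1\<close> and \<open>num = -1\<close>, so \<open>quad\<close>
    takes the value 3.\<close>
  have "eval_point (tuple4 1 0 0 0) s = 3"
    by (simp add: s_def den_def num_def quad_def eval_point_simps)
  then have "s \<noteq> 0"
    using three by (intro neq_0_point[of "tuple4 1 0 0 0" s]) simp
  have "den (var :: 4 \<Rightarrow> (4, 'k) mpoly) \<noteq> 0"
    using \<open>s \<noteq> 0\<close> by (auto simp: s_def)
  then have g0: "?g 0 \<noteq> 0"
    by (simp add: psi_inv_def fibre_line_def var_neq_0)
  \<comment> \<open>By \<open>I\<close>, the ideal is the kernel of a homomorphism to a domain,
    which gives primality.\<close>
  have "projective_variety ?I"
    unfolding projective_variety_def prime_ideal_def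
  proof (intro conjI ballI allI impI)
    show "homogeneous_component d p \<in> ?I" if "p \<in> ?I" for p d
      using that subst_homogeneous_component_eq_0[of 4 ?g p d] by (simp add: I homogeneous_psi_inv)
    show "\<exists>i. var i \<notin> ?I"
      using g0 by (auto simp: I subst_of_var)
  qed (auto simp: I subst_simps)
  moreover have "projective_variety ?J"
    unfolding projective_variety_def prime_ideal_def
    by (auto simp: J homogeneous_component_def var_neq_0)
  moreover have "rational_map ?I ?J ?f"
    unfolding rational_map_def
  proof (intro conjI exI allI ballI)
    show "homogeneous 3 (?f j)" for j by (rule homogeneous_psi)
    show "?f 0 \<notin> ?I"
      by (simp add: I subst_psi fg \<open>s \<noteq> 0\<close> var_neq_0)
    show "subst ?f q \<in> ?I" if "q \<in> ?J" for q
      using that by (simp add: I J subst_simps)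
  qed
  moreover have "dominant ?I ?J ?f"
    unfolding dominant_def
  proof (intro allI impI, elim conjE)
    fix e q assume q: "homogeneous e q" and "subst ?f q \<in> ?I"
    \<comment> \<open>Vanishing on the source is tested after substituting \<open>?g\<close>; the
      composite with \<open>?f\<close> only rescales the variables by \<open>s\<close>.\<close>
    then have "subst (\<lambda>i. s * var i) q = 0"
      by (simp add: I subst_subst subst_psi fg)
    then show "q \<in> ?J"
      by (simp add: J subst_homogeneous[OF q] subst_var \<open>s \<noteq> 0\<close>)
  qed
  moreover have "rational_map ?J ?I ?g"
    unfolding rational_map_def
  proof (intro conjI exI allI ballI)
    show "homogeneous 4 (?g j)" for j by (rule homogeneous_psi_inv)
    show "?g 0 \<notin> ?J" using g0 by (simp add: J)
  qed (simp add: I J)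
  moreover have "dominant ?J ?I ?g"
    by (simp add: dominant_def I J)
  \<comment> \<open>After substituting \<open>?g\<close>, both families are proportional to
    \<open>?g\<close> itself, by \<open>gf\<close>.\<close>
  moreover have "same_rational_map ?I (rational_comp ?g ?f) var"
    unfolding same_rational_map_def rational_comp_def
    by (simp add: I subst_simps subst_psi_inv hom_psi_inv[OF ring_hom_fun_subst] subst_psi gf)
  moreover have "same_rational_map ?J (rational_comp ?f ?g) var"
    unfolding same_rational_map_def rational_comp_def
    by (simp add: J subst_psi fg)
  ultimately show ?thesis
    unfolding birational_map_def burkhardt_psi_eq by blast
qed

end
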